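(* Let $(x^k,\lambda^k)_{k\ge 1}$ and $(\beta_k)_{k\ge1}$ be generated by the IADMM algorithm described in the context, and let $x^*=(y^*,z^* )$ be the primal part of a KKT solution $(x^*,\lambda^* )$ of the problem $\min\{f(y)+g(z) : By+Cz=b\}$. Define $\gamma_k:=\sum_{i=1}^k\beta_i$ and $v^k:=\frac{\sum_{i=1}^{k}\beta_i x^{i+1}}{\sum_{i=1}^k\beta_i}$. Then, as $k\to\infty$, $$|\mathcal F(v^k)-\mathcal F(x^* )|=O(1/k),\qquad \|\mathcal A v^k-b\|=O(1/k).$$ Moreover, if $\gamma_k=\Omega(k^2)$, then $$|\mathcal F(v^k)-\mathcal F(x^* )|=O(1/k^2),\qquad \|\mathcal A v^k-b\|=O(1/k^2).$$
   Context: Problem: $\min\{f(y)+g(z): By+Cz=b\}$, where $B\in\mathbb R^{m\times n_1}$, $C\in\mathbb R^{m\times n_2}$, $b\in\mathbb R^m$, and $f:\mathbb R^{n_1}\to(-\infty,\infty]$, $g:\mathbb R^{n_2}\to(-\infty,\infty]$ are proper, lower semicontinuous and convex. There is $\sigma_g\ge 0$ such that $g(x)-g(y)\ge\langle\xi,x-y\rangle+\frac{\sigma_g}{2}\|x-y\|^2$ for all $x,y\in\mathbb R^{n_2}$ and all $\xi\in\partial g(y)$ (when $\sigma_g>0$ the function $g$ is strongly convex and the problem is called semi-strongly convex). Notation: $x=(y,z)$, $\mathcal F(x)=f(y)+g(z)$, $\mathcal A x=By+Cz$, $\|\cdot\|$ is the Euclidean norm. A triple $(y,z,\lambda)$ is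 a KKT solution if $0\in\partial f(y)+B^\top\lambda$, $0\in\partial g(z)+C^\top\lambda$ and $By+Cz-b=0$. The set of KKT solutions is assumed nonempty. For a symmetric positive semidefinite matrix $D$, $\|w\|_D=\sqrt{\langle w,Dw\rangle}$; $\succeq,\preceq$ denote the Loewner order. A sequence $a_k$ is $\Omega(k^2)$ if there are $c>0$ and $N_0$ with $a_k\ge ck^2$ for all $k\ge N_0$. IADMM algorithm: choose $x^1=(y^1,z^1)$, $\lambda^1$, constants $\gamma\in(1,\frac{1+\sqrt5}{2})$ and $\epsilon,\beta,\tau\in(0,1)$, an initial penalty $\beta_1\in[\beta,\infty)$, a symmetric matrix $Q\succeq0$, and symmetric matrices $P_k\succeq0$ $(k\ge1)$ with $\beta_{k+1}P_{k+1}\preceq\beta_kP_k$ for all $k\ge1$; set $Q_k=\beta_kQ$. It is assumed that $\lambda_{\max}(C^\top C+Q)>0$. For $k=1,2,\dots$: 1. $y^{k+1}\in\arg\min_y\{f(y)+\langle\lambda^k,By\rangle+\frac{\beta_k}{2}\|By+Cz^k-b\|^2+\frac12\|y-y^k\|^2_{P_k}\}$; 2. $z^{k+1}\in\arg\min_z\{g(z)+\langle\lambda^k,Cz\rangle+\frac{\beta_k}{2}\|By^{k+1}+Cz-b\|^2+\frac12\|z-z^k\|^2_{Q_k}\}$; 3. $\lambda^{k+1}=\lambda^k+\gamma\beta_k(By^{k+1}+Cz^{k+1}-b)$; 4. choose any $\beta_{k+1}\in\left[\max\{\beta,\tau\beta_k\},\ \sqrt{\beta_k^2+\frac{(1-\epsilon)\sigma_g\beta_k}{\lambda_{\max}(C^\top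 C+Q)}}\right]$. Every subproblem is assumed to be well-defined with an optimal solution. *)

theory Defs
  imports "HOL-Analysis.Analysis" "HOL-Library.Landau_Symbols"
begin

section \<open>Extended-real-valued convex functions\<close>

definition proper_fun :: "('a \<Rightarrow> ereal) \<Rightarrow> bool" where
  "proper_fun f \<longleftrightarrow> (\<forall>x. f x \<noteq> -\<infinity>) \<and> (\<exists>x. f x \<noteq> \<infinity>)"

definition lower_semicont :: "('a::topological_space \<Rightarrow> ereal) \<Rightarrow> bool" where
  "lower_semicont f \<longleftrightarrow> (\<forall>x. f x \<le> Liminf (at x) f)"

text \<open>Meant for functions that never take the value \<open>-\<infinity>\<close>, so that the right-hand side
  contains no \<open>\<infinity> - \<infinity>\<close>; the library's \<open>convex_on\<close> covers real-valued functions only.\<close>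

definition ereal_convex :: "('a::real_vector \<Rightarrow> ereal) \<Rightarrow> bool" where
  "ereal_convex f \<longleftrightarrow>
     (\<forall>x y. \<forall>t\<in>{0..1}. f ((1 - t) *\<^sub>R x + t *\<^sub>R y) \<le> ereal (1 - t) * f x + ereal t * f y)"

text \<open>For proper \<open>f\<close> this set is empty wherever \<open>f\<close> is infinite.\<close>

definition subdifferential :: "('a::real_inner \<Rightarrow> ereal) \<Rightarrow> 'a \<Rightarrow> 'a set" where
  "subdifferential f y = {\<xi>. \<forall>x. f y + ereal (\<xi> \<bullet> (x - y)) \<le> f x}"

text \<open>The inequality through which the modulus \<open>\<sigma>\<close> enters; \<open>\<sigma> = 0\<close> is allowed.\<close>

definition convexity_modulus :: "('a::real_inner \<Rightarrow> ereal) \<Rightarrow> real \<Rightarrow> bool" where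
  "convexity_modulus g \<sigma> \<longleftrightarrow>
     (\<forall>x y. \<forall>\<xi>\<in>subdifferential g y.
        g x - g y \<ge> ereal (\<xi> \<bullet> (x - y) + \<sigma> / 2 * (norm (x - y))\<^sup>2))"

section \<open>Positive semidefinite matrices\<close>

definition psd :: "real^'n^'n \<Rightarrow> bool" where
  "psd D \<longleftrightarrow> transpose D = D \<and> (\<forall>w. 0 \<le> w \<bullet> (D *v w))"

definition loewner_le :: "real^'n^'n \<Rightarrow> real^'n^'n \<Rightarrow> bool" where
  "loewner_le D E \<longleftrightarrow> psd (E - D)"

definition seminorm :: "real^'n^'n \<Rightarrow> real^'n \<Rightarrow> real" where
  "seminorm D w = sqrt (w \<bullet> (D *v w))"

definition eigenvalues :: "real^'n^'n \<Rightarrow> real set" where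
  "eigenvalues D = {\<mu>. \<exists>v. v \<noteq> 0 \<and> D *v v = \<mu> *\<^sub>R v}"

text \<open>Used for symmetric matrices only, whose set of real eigenvalues is finite and nonempty.\<close>

definition lambda_max :: "real^'n^'n \<Rightarrow> real" where
  "lambda_max D = Max (eigenvalues D)"

section \<open>The problem and its KKT solutions\<close>

definition objective ::
  "('a \<Rightarrow> ereal) \<Rightarrow> ('b \<Rightarrow> ereal) \<Rightarrow> 'a \<times> 'b \<Rightarrow> ereal" where
  "objective f g x = f (fst x) + g (snd x)"

definition constr_map ::
  "real^'n1^'m \<Rightarrow> real^'n2^'m \<Rightarrow> (real^'n1) \<times> (real^'n2) \<Rightarrow> real^'m" where
  "constr_map B C x = B *v fst x + C *v snd x"

definition kkt_solution ::
  "(real^'n1 \<Rightarrow> ereal) \<Rightarrow> (real^'n2 \<Rightarrow> ereal) \<Rightarrow> real^'n1^'m \<Rightarrow> real^'n2^'m \<Rightarrow> real^'m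
   \<Rightarrow> real^'n1 \<Rightarrow> real^'n2 \<Rightarrow> real^'m \<Rightarrow> bool" where
  "kkt_solution f g B C b y z l \<longleftrightarrow>
     0 \<in> (transpose B *v l) +o subdifferential f y \<and>
     0 \<in> (transpose C *v l) +o subdifferential g z \<and>
     B *v y + C *v z - b = 0"

section \<open>The algorithm\<close>

text \<open>Iterates are indexed from 1; the entries at index 0 are never used. The penalties
  \<open>\<beta>\<^sub>k\<close> are \<open>pen k\<close>, and \<open>\<beta>\<close> is their lower bound. Since \<open>f\<close> and \<open>g\<close> are proper, an
  unconstrained minimiser in the sense of \<open>is_arg_min\<close> has a finite value.\<close>

definition iadmm_iterates ::
  "(real^'n1 \<Rightarrow> ereal) \<Rightarrow> (real^'n2 \<Rightarrow> ereal) \<Rightarrow> real^'n1^'m \<Rightarrow> real^'n2^'m \<Rightarrow> real^'m \<Rightarrow> real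
   \<Rightarrow> real \<Rightarrow> real \<Rightarrow> real \<Rightarrow> real \<Rightarrow> real^'n2^'n2 \<Rightarrow> (nat \<Rightarrow> real^'n1^'n1)
   \<Rightarrow> (nat \<Rightarrow> real^'n1) \<Rightarrow> (nat \<Rightarrow> real^'n2) \<Rightarrow> (nat \<Rightarrow> real^'m) \<Rightarrow> (nat \<Rightarrow> real) \<Rightarrow> bool" where
  "iadmm_iterates f g B C b \<sigma> \<gamma> \<epsilon> \<beta> \<tau> Q P y z l pen \<longleftrightarrow>
     pen 1 \<ge> \<beta> \<and>
     (\<forall>k\<ge>1.
        is_arg_min
          (\<lambda>u. f u + ereal (l k \<bullet> (B *v u) + pen k / 2 * (norm (B *v u + C *v z k - b))\<^sup>2
                 + 1 / 2 * (seminorm (P k) (u - y k))\<^sup>2))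
          (\<lambda>_. True) (y (k + 1)) \<and>
        is_arg_min
          (\<lambda>w. g w + ereal (l k \<bullet> (C *v w) + pen k / 2 * (norm (B *v y (k + 1) + C *v w - b))\<^sup>2
                 + 1 / 2 * (seminorm (pen k *\<^sub>R Q) (w - z k))\<^sup>2))
          (\<lambda>_. True) (z (k + 1)) \<and>
        l (k + 1) = l k + (\<gamma> * pen k) *\<^sub>R (B *v y (k + 1) + C *v z (k + 1) - b) \<and>
        pen (k + 1) \<in> {max \<beta> (\<tau> * pen k) ..
          sqrt ((pen k)\<^sup>2 + (1 - \<epsilon>) * \<sigma> * pen k / lambda_max (transpose C ** C + Q))})"

definition weight :: "(nat \<Rightarrow> real) \<Rightarrow> nat \<Rightarrow> real" where
  "weight pen k = (\<Sum>i=1..k. pen i)"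

definition ergodic_avg :: "(nat \<Rightarrow> real) \<Rightarrow> (nat \<Rightarrow> 'a::real_vector) \<Rightarrow> nat \<Rightarrow> 'a" where
  "ergodic_avg pen x k = (1 / weight pen k) *\<^sub>R (\<Sum>i=1..k. pen i *\<^sub>R x (i + 1))"

text \<open>The library's \<open>O\<close> is restricted to normed fields. This is its defining condition for
  extended-real-valued sequences; it forces \<open>a k\<close> to be finite for all large \<open>k\<close>.\<close>

definition ereal_bigo :: "(nat \<Rightarrow> ereal) \<Rightarrow> (nat \<Rightarrow> real) \<Rightarrow> bool" where
  "ereal_bigo a h \<longleftrightarrow> (\<exists>c>0. \<forall>\<^sub>F k in sequentially. \<bar>a k\<bar> \<le> ereal (c * norm (h k)))"

end

theory Submission
  imports Defs
begin

text \<open>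
  The ergodic average weights the iterates by the penalties, so both error measures reduce to
  sums over the run. For feasibility the multiplier update gives
  \<open>\<gamma> \<Sum>\<^sub>i \<beta>\<^sub>i (\<A> x\<^sup>i\<^sup>+\<^sup>1 - b) = \<lambda>\<^sup>k\<^sup>+\<^sup>1 - \<lambda>\<^sup>1\<close>, hence
  \<open>\<A> v\<^sup>k - b = (\<lambda>\<^sup>k\<^sup>+\<^sup>1 - \<lambda>\<^sup>1) / (\<gamma> \<gamma>\<^sub>k)\<close>, and it is enough that the multipliers stay bounded.
  For the objective, convexity bounds \<open>\<F>(v\<^sup>k) - \<F>(x\<^sup>*)\<close> above by the weighted mean of the gaps
  of the iterates, and the KKT conditions bound it below by \<open>- \<langle>\<lambda>\<^sup>*, \<A> v\<^sup>k - b\<rangle>\<close>. So everything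
  is of order \<open>1 / \<gamma>\<^sub>k\<close> once \<open>\<Sum>\<^sub>i \<beta>\<^sub>i (\<F>(x\<^sup>i\<^sup>+\<^sup>1) - \<F>(x\<^sup>*))\<close> is bounded above and the multipliers
  are bounded.

  Both come from an energy that decreases by at least \<open>\<beta>\<^sub>k (\<F>(x\<^sup>k\<^sup>+\<^sup>1) - \<F>(x\<^sup>*))\<close> per step
  (\<open>energy_descent\<close>). Testing the optimality conditions of the two subproblems with \<open>x\<^sup>*\<close> and
  multiplying by \<open>\<beta>\<^sub>k\<close> yields a telescoping potential (\<open>gap_descent\<close>): its \<open>z\<close>-part
  \<open>\<beta>\<^sub>k\<^sup>2 \<parallel>z\<^sup>* - z\<^sup>k\<parallel>\<^sup>2 / 2\<close>, in the seminorm of \<open>C\<^sup>T C + Q\<close>, telescopes in spite of growing penalties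
  because the upper bound on \<open>\<beta>\<^sub>k\<^sub>+\<^sub>1\<close> lets the strong convexity of \<open>g\<close> pay for the growth
  (\<open>penalty_growth\<close>). Since the dual step \<open>\<gamma>\<close> exceeds 1, an inner product of the step in \<open>z\<close> with
  the residual remains. Monotonicity of the subdifferential of \<open>g\<close> at consecutive iterates trades
  it for one with the previous residual (\<open>cross_term\<close>), whose square, with coefficient
  \<open>(\<gamma> - 1)\<^sup>2 / 2\<close>, must be absorbed by the coefficient \<open>1 - \<gamma> / 2\<close> already available. This is
  possible exactly when \<open>\<gamma>\<^sup>2 - \<gamma> - 1 \<le> 0\<close>, that is, up to the golden ratio.

  Summing the descent bounds the weighted gaps. Combined with the lower bound on each gap, it
  bounds \<open>\<parallel>\<lambda>\<^sup>k - \<lambda>\<^sup>*\<parallel>\<close> (\<open>multipliers_bounded\<close>). The two claimed rates are the cases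
  \<open>\<gamma>\<^sub>k \<ge> \<beta> k\<close> and \<open>\<gamma>\<^sub>k \<ge> c k\<^sup>2\<close> of one estimate (\<open>ergodic_rate\<close>).
\<close>

section \<open>Quadratic forms of symmetric matrices\<close>

definition qform :: "real^'n^'n \<Rightarrow> real^'n \<Rightarrow> real" where
  "qform D w = w \<bullet> (D *v w)"

lemma symmetric_inner_commute:
  fixes D :: "real^'n^'n"
  assumes "transpose D = D"
  shows "x \<bullet> (D *v y) = y \<bullet> (D *v x)"
  by (metis assms dot_lmul_matrix inner_commute transpose_matrix_vector)

lemma qform_add:
  assumes "transpose D = D"
  shows "qform D (x + y) = qform D x + 2 * (x \<bullet> (D *v y)) + qform D y"
  using symmetric_inner_commute[OF assms, of y x]
  by (simp add: qform_def matrix_vector_right_distrib inner_add_left inner_add_right)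

lemma qform_scaleR: "qform D (t *\<^sub>R w) = t\<^sup>2 * qform D w"
  by (simp add: qform_def matrix_vector_mult_scaleR power2_eq_square)

lemma qform_minus: "qform D (- w) = qform D w"
  using qform_scaleR[of D "-1" w] by simp

lemma qform_three_point:
  assumes "transpose D = D"
  shows "2 * ((p - q) \<bullet> (D *v (q - r))) = qform D (p - r) - qform D (p - q) - qform D (q - r)"
  using qform_add[OF assms, of "p - q" "q - r"] by simp

lemma psd_qform_nonneg: "psd D \<Longrightarrow> 0 \<le> qform D w"
  by (simp add: psd_def qform_def)

lemma qform_young:
  assumes "psd D"
  shows "2 * (x \<bullet> (D *v y)) \<le> qform D x + qform D y"
  using qform_add[of D x "- y"] psd_qform_nonneg[OF assms, of "x - y"] assms
  by (simp add: psd_def qform_minus linear_neg)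

lemma seminorm_squared: "psd D \<Longrightarrow> (seminorm D w)\<^sup>2 = qform D w"
  by (simp add: seminorm_def qform_def psd_def)

lemma psd_scaleR:
  assumes "psd D" "0 \<le> t"
  shows "psd (t *\<^sub>R D)"
  using assms by (simp add: psd_def transpose_scalar flip: scaleR_matrix_vector_assoc)

lemma qform_gram_add:
  fixes C :: "real^'n^'m"
  shows "qform (transpose C ** C + Q) w = (norm (C *v w))\<^sup>2 + qform Q w"
proof -
  have "w \<bullet> (transpose C *v (C *v w)) = (C *v w) \<bullet> (C *v w)"
    by (metis dot_lmul_matrix inner_commute transpose_matrix_vector)
  then show ?thesis
    by (simp add: qform_def matrix_vector_mult_add_rdistrib inner_add_right 
        power2_norm_eq_inner flip: matrix_vector_mul_assoc)
qed

lemma psd_gram_add: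
  fixes C :: "real^'n^'m"
  assumes "psd Q"
  shows "psd (transpose C ** C + Q)"
proof -
  have "transpose (transpose C ** C + Q) = transpose (transpose C ** C) + transpose Q"
    by (simp add: transpose_def vec_eq_iff)
  then have "transpose (transpose C ** C + Q) = transpose C ** C + Q"
    using assms by (simp add: psd_def matrix_transpose_mul)
  moreover have "0 \<le> qform (transpose C ** C + Q) w" for w
    using psd_qform_nonneg[OF assms] by (simp add: qform_gram_add)
  ultimately show ?thesis by (simp add: psd_def qform_def)
qed

text \<open>If \<open>H v \<noteq> 0\<close>, then moving from \<open>v\<close> against \<open>H v\<close> would make the form negative to first
  order.\<close>

lemma psd_qform_eq_0:
  assumes "psd H" "qform H v = 0"
  shows "H *v v = 0"
proof -
  define w where "w = H *v v"
  define c where "c = qform H w"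
  \<comment> \<open>Near the minimiser \<open>- (w \<bullet> w) / c\<close> of the resulting quadratic in \<open>t\<close>; the shift by 1
    covers \<open>c = 0\<close>.\<close>
  define t where "t = - (w \<bullet> w) / (c + 1)"
  have c: "c \<ge> 0" using psd_qform_nonneg[OF assms(1)] by (simp add: c_def)
  have "0 \<le> qform H (t *\<^sub>R w + v)" by (rule psd_qform_nonneg[OF assms(1)])
  also have "\<dots> = t\<^sup>2 * c + 2 * t * (w \<bullet> w)"
    using assms by (simp add: psd_def qform_add qform_scaleR c_def w_def)
  also have "\<dots> = - ((w \<bullet> w)\<^sup>2 * (c + 2) / (c + 1)\<^sup>2)"
    using c by (simp add: t_def divide_simps power2_eq_square) (simp add: algebra_simps)
  finally have "(w \<bullet> w)\<^sup>2 * (c + 2) / (c + 1)\<^sup>2 \<le> 0" by simp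
  then have "(w \<bullet> w)\<^sup>2 \<le> 0" using c by (simp add: divide_le_0_iff mult_le_0_iff)
  then show ?thesis by (simp add: w_def)
qed

text \<open>Eigenvectors of distinct eigenvalues are orthogonal, hence independent. Finiteness is what makes
  the \<open>Max\<close> in \<open>lambda_max\<close> an upper bound of the eigenvalues.\<close>

lemma finite_eigenvalues_symmetric:
  fixes D :: "real^'n^'n"
  assumes sym: "transpose D = D"
  shows "finite (eigenvalues D)"
proof -
  define e where "e \<mu> = (SOME v. v \<noteq> 0 \<and> D *v v = \<mu> *\<^sub>R v)" for \<mu>
  have e: "e \<mu> \<noteq> 0" "D *v e \<mu> = \<mu> *\<^sub>R e \<mu>" if "\<mu> \<in> eigenvalues D" for \<mu>
    using someI_ex[of "\<lambda>v. v \<noteq> 0 \<and> D *v v = \<mu> *\<^sub>R v"] that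
    by (auto simp: eigenvalues_def e_def)
  have orth: "e \<mu> \<bullet> e \<nu> = 0" if "\<mu> \<in> eigenvalues D" "\<nu> \<in> eigenvalues D" "\<mu> \<noteq> \<nu>" for \<mu> \<nu>
    using symmetric_inner_commute[OF sym, of "e \<mu>" "e \<nu>"] that
    by (simp add: e inner_commute)
  have inj: "inj_on e (eigenvalues D)"
    by (metis e(1) inj_onI inner_eq_zero_iff orth)
  have "independent (e ` eigenvalues D)"
    using e(1) orth
    by (intro pairwise_orthogonal_independent) (auto simp: pairwise_def orthogonal_def)
  then show ?thesis
    using finite_imageD[OF independent_imp_finite inj] by blast
qed

text \<open>A maximiser \<open>v\<close> of the form on the unit sphere exists by compactness. With \<open>M\<close> the maximum, the
  form of \<open>M I - D\<close> is nonnegative and vanishes at \<open>v\<close>, so \<open>v\<close> is an eigenvector with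
  eigenvalue \<open>M\<close>.\<close>

lemma qform_le_lambda_max:
  fixes D :: "real^'n^'n"
  assumes sym: "transpose D = D"
  shows "qform D w \<le> lambda_max D * (norm w)\<^sup>2"
proof -
  have "continuous_on (sphere 0 1) (qform D)"
    unfolding qform_def by (intro continuous_intros linear_continuous_on matrix_vector_mul_bounded_linear)
  moreover have "sphere (0::real^'n) 1 \<noteq> {}" by simp
  ultimately obtain v where v: "norm v = 1" and max: "\<And>u. norm u = 1 \<Longrightarrow> qform D u \<le> qform D v"
    using continuous_attains_sup[OF compact_sphere, of 0 1 "qform D"] by auto
  define M where "M = qform D v"
  have le: "qform D u \<le> M * (norm u)\<^sup>2" for u
  proof (cases "u = 0")
    case False
    then have "qform D u = (norm u)\<^sup>2 * qform D ((1 / norm u) *\<^sub>R u)"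
      by (simp add: qform_scaleR power_divide)
    also have "\<dots> \<le> (norm u)\<^sup>2 * M"
      using False by (intro mult_left_mono) (auto simp: M_def intro!: max)
    finally show ?thesis by (simp add: mult.commute)
  qed (simp add: qform_def)
  define H where "H = M *\<^sub>R mat 1 - D"
  have H: "H *v u = M *\<^sub>R u - D *v u" for u
    by (simp add: H_def matrix_vector_mult_diff_rdistrib flip: scaleR_matrix_vector_assoc)
  have "transpose H = M *\<^sub>R transpose (mat 1) - transpose D"
    by (simp add: H_def transpose_def vec_eq_iff)
  then have "transpose H = H"
    by (simp add: sym H_def)
  then have "psd H"
    using le by (simp add: psd_def H qform_def inner_diff_right power2_norm_eq_inner)
  moreover have "qform H v = 0" using v by (simp add: qform_def H inner_diff_right M_def power2_norm_eq_inner[symmetric])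
  ultimately have "D *v v = M *\<^sub>R v" using psd_qform_eq_0 H by fastforce
  then have "M \<in> eigenvalues D" using v by (auto simp: eigenvalues_def intro!: exI[of _ v])
  then have "M \<le> lambda_max D"
    by (simp add: lambda_max_def finite_eigenvalues_symmetric[OF sym])
  then show ?thesis using le[of w] by (meson mult_right_mono order_trans zero_le_power2)
qed
section \<open>Subgradients\<close>

lemma zero_mem_elt_set_plus_iff: "0 \<in> a +o S \<longleftrightarrow> - a \<in> S" for a :: "'a::ab_group_add"
  by (auto simp: elt_set_plus_def intro!: bexI[of _ "- a"]) (metis minus_unique)

lemma subdifferential_finite:
  assumes "proper_fun f" "\<xi> \<in> subdifferential f y"
  shows "\<bar>f y\<bar> \<noteq> \<infinity>"
proof -
  obtain x where "f x \<noteq> \<infinity>" using assms(1) by (auto simp: proper_fun_def)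
  moreover have "f y + ereal (\<xi> \<bullet> (x - y)) \<le> f x" using assms(2) by (simp add: subdifferential_def)
  ultimately show ?thesis using assms(1) by (cases "f y") (auto simp: proper_fun_def)
qed

lemma subdifferential_real:
  assumes "proper_fun f" "\<xi> \<in> subdifferential f y" "\<bar>f x\<bar> \<noteq> \<infinity>"
  shows "real_of_ereal (f y) + \<xi> \<bullet> (x - y) \<le> real_of_ereal (f x)"
proof -
  have "f y + ereal (\<xi> \<bullet> (x - y)) \<le> f x" using assms(2) by (simp add: subdifferential_def)
  then show ?thesis using assms(3) subdifferential_finite[OF assms(1,2)]
    by (cases "f x"; cases "f y") auto
qed

lemma convexity_modulus_real:
  assumes "proper_fun g" "convexity_modulus g \<sigma>" "\<xi> \<in> subdifferential g y" "\<bar>g x\<bar> \<noteq> \<infinity>"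
  shows "real_of_ereal (g y) + \<xi> \<bullet> (x - y) + \<sigma> / 2 * (norm (x - y))\<^sup>2 \<le> real_of_ereal (g x)"
proof -
  have "g x - g y \<ge> ereal (\<xi> \<bullet> (x - y) + \<sigma> / 2 * (norm (x - y))\<^sup>2)"
    using assms(2,3) by (simp add: convexity_modulus_def)
  then show ?thesis using assms(4) subdifferential_finite[OF assms(1,3)]
    by (cases "g x"; cases "g y") auto
qed

lemma subdifferential_monotone:
  assumes "proper_fun f" "\<xi> \<in> subdifferential f x" "\<eta> \<in> subdifferential f y"
  shows "0 \<le> (\<xi> - \<eta>) \<bullet> (x - y)"
  using subdifferential_real[OF assms(1,2) subdifferential_finite[OF assms(1,3)]]
    subdifferential_real[OF assms(1,3) subdifferential_finite[OF assms(1,2)]]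
  by (simp add: inner_diff_left inner_diff_right)

text \<open>Fermat's rule for a convex function plus a smooth one. Comparing \<open>u\<close> with a point at a fraction
  \<open>t\<close> of the way to \<open>x\<close>, and using convexity of \<open>f\<close> only, leaves the subgradient inequality with
  an error of order \<open>t\<close>. An exact second-order expansion of \<open>\<phi>\<close> along each direction suffices here,
  since the smooth parts below are quadratic.\<close>

lemma arg_min_subgradient:
  fixes f :: "'a::real_inner \<Rightarrow> ereal" and \<phi> :: "'a \<Rightarrow> real"
  assumes f: "proper_fun f" "ereal_convex f"
    and min: "is_arg_min (\<lambda>x. f x + ereal (\<phi> x)) (\<lambda>_. True) u"
    and expand: "\<And>d t. \<phi> (u + t *\<^sub>R d) = \<phi> u + t * (\<zeta> \<bullet> d) + t\<^sup>2 * \<kappa> d"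
  shows "- \<zeta> \<in> subdifferential f u"
proof -
  have le: "f u + ereal (\<phi> u) \<le> f x + ereal (\<phi> x)" for x
    using min by (auto simp: is_arg_min_linorder)
  obtain x0 where "f x0 \<noteq> \<infinity>" using f(1) by (auto simp: proper_fun_def)
  then have "f u \<noteq> \<infinity>" using le[of x0] by auto
  then obtain r where r: "f u = ereal r" using f(1) by (cases "f u") (auto simp: proper_fun_def)
  have "f u + ereal (- \<zeta> \<bullet> (x - u)) \<le> f x" for x
  proof (cases "f x")
    case (real s)
    define d where "d = x - u"
    have step: "r - s - \<zeta> \<bullet> d \<le> t * \<kappa> d" if t: "0 < t" "t \<le> 1" for t
    proof -
      have "f (u + t *\<^sub>R d) \<le> ereal (1 - t) * f u + ereal t * f x"
        using f(2) t unfolding ereal_convex_def d_def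
        by (metis (no_types, lifting) add_diff_eq atLeastAtMost_iff diff_add_eq less_imp_le
            real_vector.scale_left_diff_distrib real_vector.scale_right_diff_distrib scaleR_one)
      then have "f (u + t *\<^sub>R d) \<le> ereal ((1 - t) * r + t * s)" by (simp add: r real)
      then have "f (u + t *\<^sub>R d) + ereal (\<phi> (u + t *\<^sub>R d))
          \<le> ereal ((1 - t) * r + t * s) + ereal (\<phi> (u + t *\<^sub>R d))"
        by (rule add_right_mono)
      with le[of "u + t *\<^sub>R d"] have "ereal (r + \<phi> u) \<le> ereal ((1 - t) * r + t * s + \<phi> (u + t *\<^sub>R d))"
        by (metis order_trans plus_ereal.simps(1) r)
      then have "t * (r - s - \<zeta> \<bullet> d) \<le> t * (t * \<kappa> d)"
        by (simp add: expand algebra_simps power2_eq_square)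
      then show ?thesis using t(1) by simp
    qed
    have "((\<lambda>t. t * \<kappa> d) \<longlongrightarrow> 0 * \<kappa> d) (at_right 0)" by (intro tendsto_intros)
    moreover have "\<forall>\<^sub>F t in at_right 0. r - s - \<zeta> \<bullet> d \<le> t * \<kappa> d"
      using step by (auto simp: eventually_at_right_field intro!: exI[of _ 1])
    ultimately have "r - s - \<zeta> \<bullet> d \<le> 0"
      by (metis mult_zero_left tendsto_lowerbound trivial_limit_at_right_real)
    then show ?thesis by (simp add: r real d_def)
  qed (use r f(1) in \<open>auto simp: proper_fun_def\<close>)
  then show ?thesis by (simp add: subdifferential_def)
qed

text \<open>Both subproblems of an iteration have this form, with \<open>A\<close> one of the two constraint matrices
  and \<open>c\<close> collecting the part of the constraint in the other variable.\<close>

lemma proximal_subproblem_subgradient: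
  fixes A :: "real^'n^'m"
  assumes f: "proper_fun f" "ereal_convex f" and D: "psd D"
    and min: "is_arg_min
      (\<lambda>x. f x + ereal (\<mu> \<bullet> (A *v x) + p / 2 * (norm (A *v x - c))\<^sup>2 + 1 / 2 * (seminorm D (x - x0))\<^sup>2))
      (\<lambda>_. True) u"
  shows "- (transpose A *v (\<mu> + p *\<^sub>R (A *v u - c)) + D *v (u - x0)) \<in> subdifferential f u"
proof (rule arg_min_subgradient[OF f min])
  fix d and t :: real
  define a where "a = A *v u - c"
  have adj: "(transpose A *v w) \<bullet> d = w \<bullet> (A *v d)" for w
    by (simp add: dot_lmul_matrix)
  have residual: "A *v (u + t *\<^sub>R d) - c = a + t *\<^sub>R (A *v d)"
    by (simp add: a_def matrix_vector_right_distrib matrix_vector_mult_scaleR)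
  have sq: "(norm (a + t *\<^sub>R (A *v d)))\<^sup>2 = (norm a)\<^sup>2 + 2 * t * (a \<bullet> (A *v d)) + t\<^sup>2 * (norm (A *v d))\<^sup>2"
    unfolding power2_norm_eq_inner
    by (simp add: inner_add_left inner_add_right inner_commute power2_eq_square)
  have prox: "(seminorm D (u + t *\<^sub>R d - x0))\<^sup>2
      = (seminorm D (u - x0))\<^sup>2 + 2 * t * ((D *v (u - x0)) \<bullet> d) + t\<^sup>2 * qform D d"
    using qform_add[of D "t *\<^sub>R d" "u - x0"] D
    by (simp add: seminorm_squared qform_scaleR psd_def inner_commute algebra_simps)
  show "\<mu> \<bullet> (A *v (u + t *\<^sub>R d)) + p / 2 * (norm (A *v (u + t *\<^sub>R d) - c))\<^sup>2
        + 1 / 2 * (seminorm D (u + t *\<^sub>R d - x0))\<^sup>2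
      = \<mu> \<bullet> (A *v u) + p / 2 * (norm (A *v u - c))\<^sup>2 + 1 / 2 * (seminorm D (u - x0))\<^sup>2
        + t * ((transpose A *v (\<mu> + p *\<^sub>R (A *v u - c)) + D *v (u - x0)) \<bullet> d)
        + t\<^sup>2 * (p / 2 * (norm (A *v d))\<^sup>2 + 1 / 2 * qform D d)"
    unfolding residual sq prox inner_add_left adj a_def[symmetric]
    by (simp add: matrix_vector_right_distrib matrix_vector_mult_scaleR inner_add_right algebra_simps)
qed

section \<open>Jensen's inequality for extended-real-valued functions\<close>

text \<open>Jensen's inequality for real-valued convex functions applies on the domain of \<open>f\<close>, which is
  convex.\<close>

lemma ereal_convex_jensen:
  fixes f :: "'a::real_vector \<Rightarrow> ereal"
  assumes f: "proper_fun f" "ereal_convex f"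
    and I: "finite I" "I \<noteq> {}" and w: "\<And>i. i \<in> I \<Longrightarrow> 0 \<le> w i" "sum w I = 1"
    and fin: "\<And>i. i \<in> I \<Longrightarrow> f (x i) \<noteq> \<infinity>"
  shows "f (\<Sum>i\<in>I. w i *\<^sub>R x i) \<le> ereal (\<Sum>i\<in>I. w i * real_of_ereal (f (x i)))"
proof -
  define S where "S = {x. f x \<noteq> \<infinity>}"
  have S: "f x = ereal (real_of_ereal (f x))" if "x \<in> S" for x
    using that f(1) by (cases "f x") (auto simp: S_def proper_fun_def)
  have cvx: "f ((1 - t) *\<^sub>R x + t *\<^sub>R y) \<le> ereal ((1 - t) * real_of_ereal (f x) + t * real_of_ereal (f y))"
    if "x \<in> S" "y \<in> S" "0 \<le> t" "t \<le> 1" for x y t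
  proof -
    have "f ((1 - t) *\<^sub>R x + t *\<^sub>R y) \<le> ereal (1 - t) * f x + ereal t * f y"
      using f(2) that(3,4) by (simp add: ereal_convex_def)
    then show ?thesis using S[OF that(1)] S[OF that(2)] by (metis plus_ereal.simps(1) times_ereal.simps(1))
  qed
  have "convex S"
    using cvx by (fastforce simp: convex_alt S_def)
  then have "convex_on S (\<lambda>x. real_of_ereal (f x))"
  proof (intro convex_onI)
    fix t x y assume *: "0 < t" "t < (1::real)" "x \<in> S" "y \<in> S"
    then have "(1 - t) *\<^sub>R x + t *\<^sub>R y \<in> S" using \<open>convex S\<close> by (simp add: convex_alt)
    then show "real_of_ereal (f ((1 - t) *\<^sub>R x + t *\<^sub>R y)) \<le> (1 - t) * real_of_ereal (f x) + t * real_of_ereal (f y)"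
      using cvx[of x y t] * S by (metis ereal_less_eq(3) less_imp_le)
  qed
  then have "real_of_ereal (f (\<Sum>i\<in>I. w i *\<^sub>R x i)) \<le> (\<Sum>i\<in>I. w i * real_of_ereal (f (x i)))"
    using fin by (intro convex_on_sum[OF I _ w(2,1)]) (auto simp: S_def)
  moreover have "(\<Sum>i\<in>I. w i *\<^sub>R x i) \<in> S"
    using fin by (intro convex_sum[OF I(1) \<open>convex S\<close> w(2,1)]) (auto simp: S_def)
  ultimately show ?thesis using S by (metis ereal_less_eq(3))
qed


section \<open>One iteration of the algorithm\<close>

locale iadmm_run =
  fixes f :: "real^'n1 \<Rightarrow> ereal" and g :: "real^'n2 \<Rightarrow> ereal"
    and B :: "real^'n1^'m" and C :: "real^'n2^'m" and b :: "real^'m"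
    and \<sigma> \<gamma> \<epsilon> \<beta> \<tau> :: real
    and Q :: "real^'n2^'n2" and P :: "nat \<Rightarrow> real^'n1^'n1"
    and y :: "nat \<Rightarrow> real^'n1" and z :: "nat \<Rightarrow> real^'n2"
    and l :: "nat \<Rightarrow> real^'m" and pen :: "nat \<Rightarrow> real"
    and ystar :: "real^'n1" and zstar :: "real^'n2" and lstar :: "real^'m"
  assumes f: "proper_fun f" "ereal_convex f"
    and g: "proper_fun g" "ereal_convex g"
    and \<sigma>: "0 \<le> \<sigma>" "convexity_modulus g \<sigma>"
    and \<gamma>: "1 < \<gamma>" "\<gamma> < (1 + sqrt 5) / 2"
    and params: "0 < \<epsilon>" "0 < \<beta>"
    and Q: "psd Q"
    and P: "\<And>k. 1 \<le> k \<Longrightarrow> psd (P k)"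
      "\<And>k. 1 \<le> k \<Longrightarrow> loewner_le (pen (k + 1) *\<^sub>R P (k + 1)) (pen k *\<^sub>R P k)"
    and lmax: "0 < lambda_max (transpose C ** C + Q)"
    and iterates: "iadmm_iterates f g B C b \<sigma> \<gamma> \<epsilon> \<beta> \<tau> Q P y z l pen"
    and kkt: "kkt_solution f g B C b ystar zstar lstar"
begin

abbreviation G :: "real^'n2^'n2" where "G \<equiv> transpose C ** C + Q"

text \<open>Residuals and steps are scaled by the penalty and numbered by the iteration that produces them;
  with this scaling the energy inequality has constant coefficients.\<close>

definition res :: "nat \<Rightarrow> real^'m" where
  "res k = pen k *\<^sub>R (B *v y (k + 1) + C *v z (k + 1) - b)"

definition step :: "nat \<Rightarrow> real^'n2" where
  "step k = pen k *\<^sub>R (z (k + 1) - z k)"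

definition gap :: "nat \<Rightarrow> real" where
  "gap k = real_of_ereal (f (y k)) + real_of_ereal (g (z k))
     - (real_of_ereal (f ystar) + real_of_ereal (g zstar))"

text \<open>What telescopes after testing one iteration with the solution; the factor \<open>\<beta>\<^sub>k\<close> gained from
  weighting the gap by \<open>\<beta>\<^sub>k\<close> turns \<open>\<beta>\<^sub>k\<close> into \<open>\<beta>\<^sub>k\<^sup>2\<close> in the \<open>z\<close>-part.\<close>

definition potential :: "nat \<Rightarrow> real" where
  "potential k = (norm (l k))\<^sup>2 / (2 * \<gamma>) + (pen k)\<^sup>2 / 2 * qform G (zstar - z k)
     + pen k / 2 * qform (P k) (ystar - y k)"

text \<open>The last two terms store what \<open>cross_term\<close> charges to the previous iteration.\<close>

definition energy :: "nat \<Rightarrow> real" where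
  "energy k = potential (k + 1) + (\<gamma> - 1)\<^sup>2 / 2 * (norm (res k))\<^sup>2 + 1 / 2 * qform Q (step k)"

lemma pen_ge: "\<beta> \<le> pen k" if "1 \<le> k"
  using that
proof (induction k rule: dec_induct)
  case base
  then show ?case using iterates by (simp add: iadmm_iterates_def)
next
  case (step k)
  then have "pen (k + 1) \<ge> max \<beta> (\<tau> * pen k)"
    using iterates by (simp add: iadmm_iterates_def)
  then show ?case by simp
qed

lemma pen_pos: "1 \<le> k \<Longrightarrow> 0 < pen k"
  using pen_ge[of k] params(2) by linarith

lemma multiplier_update: "1 \<le> k \<Longrightarrow> l (k + 1) = l k + \<gamma> *\<^sub>R res k"
  using iterates by (simp add: iadmm_iterates_def res_def)

lemma kkt_primal: "B *v ystar + C *v zstar = b"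
  using kkt by (simp add: kkt_solution_def)

lemma kkt_dual:
  "- (transpose B *v lstar) \<in> subdifferential f ystar"
  "- (transpose C *v lstar) \<in> subdifferential g zstar"
  using kkt unfolding kkt_solution_def zero_mem_elt_set_plus_iff by simp_all

lemma solution_finite: "\<bar>f ystar\<bar> \<noteq> \<infinity>" "\<bar>g zstar\<bar> \<noteq> \<infinity>"
  using subdifferential_finite[OF f(1) kkt_dual(1)] subdifferential_finite[OF g(1) kkt_dual(2)] .

lemma subgradient_y:
  assumes "1 \<le> k"
  shows "- (transpose B *v (l k + (res k - C *v step k)) + P k *v (y (k + 1) - y k))
    \<in> subdifferential f (y (k + 1))"
proof -
  have "is_arg_min
      (\<lambda>u. f u + ereal (l k \<bullet> (B *v u) + pen k / 2 * (norm (B *v u - (b - C *v z k)))\<^sup>2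
         + 1 / 2 * (seminorm (P k) (u - y k))\<^sup>2)) (\<lambda>_. True) (y (k + 1))"
    using iterates assms by (simp add: iadmm_iterates_def diff_diff_eq2)
  from proximal_subproblem_subgradient[OF f P(1)[OF assms] this]
  have "- (transpose B *v (l k + pen k *\<^sub>R (B *v y (k + 1) - (b - C *v z k))) + P k *v (y (k + 1) - y k))
    \<in> subdifferential f (y (k + 1))" .
  moreover have "pen k *\<^sub>R (B *v y (k + 1) - (b - C *v z k)) = res k - C *v step k"
    by (simp add: res_def step_def matrix_vector_mult_scaleR matrix_vector_mult_diff_distrib algebra_simps)
  ultimately show ?thesis by simp
qed

lemma subgradient_z:
  assumes "1 \<le> k"
  shows "- (transpose C *v (l k + res k) + Q *v step k) \<in> subdifferential g (z (k + 1))"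
proof -
  have "is_arg_min
      (\<lambda>w. g w + ereal (l k \<bullet> (C *v w) + pen k / 2 * (norm (C *v w - (b - B *v y (k + 1))))\<^sup>2
         + 1 / 2 * (seminorm (pen k *\<^sub>R Q) (w - z k))\<^sup>2)) (\<lambda>_. True) (z (k + 1))"
    using iterates assms by (simp add: iadmm_iterates_def diff_diff_eq2 add.commute)
  from proximal_subproblem_subgradient[OF g psd_scaleR[OF Q] this]
  have "- (transpose C *v (l k + pen k *\<^sub>R (C *v z (k + 1) - (b - B *v y (k + 1))))
      + (pen k *\<^sub>R Q) *v (z (k + 1) - z k)) \<in> subdifferential g (z (k + 1))"
    using pen_pos[OF assms] by simp
  moreover have "pen k *\<^sub>R (C *v z (k + 1) - (b - B *v y (k + 1))) = res k"
    by (simp add: res_def algebra_simps)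
  moreover have "(pen k *\<^sub>R Q) *v (z (k + 1) - z k) = Q *v step k"
    by (simp add: step_def matrix_vector_mult_scaleR flip: scaleR_matrix_vector_assoc)
  ultimately show ?thesis by simp
qed

lemma iterate_finite:
  assumes "1 \<le> k"
  shows "\<bar>f (y (k + 1))\<bar> \<noteq> \<infinity>" "\<bar>g (z (k + 1))\<bar> \<noteq> \<infinity>"
  using subdifferential_finite[OF f(1) subgradient_y[OF assms]]
    subdifferential_finite[OF g(1) subgradient_z[OF assms]] .

text \<open>The rule for the next penalty allows \<open>\<beta>\<^sub>k\<^sub>+\<^sub>1\<^sup>2 - \<beta>\<^sub>k\<^sup>2\<close> to be at most
  \<open>\<sigma> \<beta>\<^sub>k / \<lambda>\<^sub>m\<^sub>a\<^sub>x(G)\<close>, and \<open>\<lambda>\<^sub>m\<^sub>a\<^sub>x(G)\<close> bounds the form of \<open>G\<close>. The extra term is exactly the strong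
  convexity gain in \<open>gap_descent\<close>.\<close>

lemma penalty_growth:
  assumes "1 \<le> k"
  shows "(pen (k + 1))\<^sup>2 * qform G w \<le> (pen k)\<^sup>2 * qform G w + pen k * \<sigma> * (norm w)\<^sup>2"
proof -
  define L where "L = lambda_max G"
  have L: "0 < L" using lmax by (simp add: L_def)
  have G: "psd G" by (rule psd_gram_add[OF Q])
  define c where "c = \<sigma> * pen k / L"
  have c0: "0 \<le> c" using \<sigma>(1) pen_pos[OF assms] L by (simp add: c_def)
  have upper: "pen (k + 1) \<le> sqrt ((pen k)\<^sup>2 + (1 - \<epsilon>) * \<sigma> * pen k / L)"
    using iterates assms by (simp add: iadmm_iterates_def L_def)
  have "(1 - \<epsilon>) * \<sigma> * pen k / L \<le> c"
    using mult_right_mono[of "1 - \<epsilon>" 1 c] c0 params(1) by (simp add: c_def mult.assoc)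
  then have "sqrt ((pen k)\<^sup>2 + (1 - \<epsilon>) * \<sigma> * pen k / L) \<le> sqrt ((pen k)\<^sup>2 + c)" by simp
  with upper have "pen (k + 1) \<le> sqrt ((pen k)\<^sup>2 + c)" by (rule order_trans)
  then have "(pen (k + 1))\<^sup>2 \<le> (sqrt ((pen k)\<^sup>2 + c))\<^sup>2"
    using pen_pos[of "k + 1"] by (intro power_mono) auto
  then have "(pen (k + 1))\<^sup>2 \<le> (pen k)\<^sup>2 + c" using c0 by simp
  then have "(pen (k + 1))\<^sup>2 * qform G w \<le> ((pen k)\<^sup>2 + c) * qform G w"
    by (rule mult_right_mono) (rule psd_qform_nonneg[OF G])
  moreover have "c * qform G w \<le> c * (L * (norm w)\<^sup>2)"
    using qform_le_lambda_max[of G w] G c0 by (intro mult_left_mono) (auto simp: psd_def L_def)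
  moreover have "c * (L * (norm w)\<^sup>2) = pen k * \<sigma> * (norm w)\<^sup>2"
    using L by (simp add: c_def)
  ultimately show ?thesis by (simp add: distrib_right)
qed

lemma proximal_monotone:
  assumes "1 \<le> k"
  shows "pen (k + 1) * qform (P (k + 1)) w \<le> pen k * qform (P k) w"
  using psd_qform_nonneg[of "pen k *\<^sub>R P k - pen (k + 1) *\<^sub>R P (k + 1)" w] P(2)[OF assms]
  by (simp add: loewner_le_def qform_def matrix_vector_mult_diff_rdistrib inner_diff_right
      flip: scaleR_matrix_vector_assoc)

text \<open>The subgradient inequalities at the new iterate are tested with the solution. Since
  \<open>B (y\<^sup>* - y\<^sup>k\<^sup>+\<^sup>1) + C (z\<^sup>* - z\<^sup>k\<^sup>+\<^sup>1)\<close> is minus the residual, the multiplier terms collapse to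
  \<open>- \<langle>\<lambda>\<^sup>k, r\<rangle>\<close>, which telescopes through the multiplier update, and the proximal terms telescope
  through the three-point identity. The lag between \<open>z\<^sup>k\<close> and \<open>z\<^sup>k\<^sup>+\<^sup>1\<close> in the \<open>y\<close>-subproblem
  produces the form of \<open>C\<^sup>T C\<close> in \<open>G\<close> and the remaining cross term.\<close>

lemma gap_descent:
  assumes k: "1 \<le> k"
  shows "pen k * gap (k + 1) \<le> potential k - potential (k + 1) + (\<gamma> / 2 - 1) * (norm (res k))\<^sup>2
    + (C *v step k) \<bullet> res k - 1 / 2 * (norm (C *v step k))\<^sup>2 - 1 / 2 * qform Q (step k)"
proof -
  note p = pen_pos[OF k]
  define ey ez dy dz where defs: "ey = ystar - y (k + 1)" "ez = zstar - z (k + 1)"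
    "dy = y (k + 1) - y k" "dz = z (k + 1) - z k"
  have step: "step k = pen k *\<^sub>R dz" by (simp add: step_def defs)
  have res: "res k = - (pen k *\<^sub>R (B *v ey + C *v ez))"
    unfolding res_def by (subst kkt_primal[symmetric])
      (simp add: defs matrix_vector_mult_diff_distrib scaleR_diff_right scaleR_add_right)
  have adjB: "(transpose B *v u) \<bullet> ey = u \<bullet> (B *v ey)" for u by (simp add: dot_lmul_matrix)
  have adjC: "(transpose C *v u) \<bullet> ez = u \<bullet> (C *v ez)" for u by (simp add: dot_lmul_matrix)
  have fy: "real_of_ereal (f (y (k + 1))) - real_of_ereal (f ystar)
      \<le> (l k + (res k - C *v step k)) \<bullet> (B *v ey) + (P k *v dy) \<bullet> ey"
    using subdifferential_real[OF f(1) subgradient_y[OF k] solution_finite(1), folded defs]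
    unfolding inner_minus_left inner_add_left[of "transpose B *v _"] adjB by linarith
  have gz: "real_of_ereal (g (z (k + 1))) - real_of_ereal (g zstar)
      \<le> (l k + res k) \<bullet> (C *v ez) + (Q *v step k) \<bullet> ez - \<sigma> / 2 * (norm ez)\<^sup>2"
    using convexity_modulus_real[OF g(1) \<sigma>(2) subgradient_z[OF k] solution_finite(2), folded defs]
    unfolding inner_minus_left inner_add_left[of "transpose C *v _"] adjC by linarith
  have bound: "pen k * gap (k + 1) \<le> pen k * ((l k + (res k - C *v step k)) \<bullet> (B *v ey) + (P k *v dy) \<bullet> ey
      + (l k + res k) \<bullet> (C *v ez) + (Q *v step k) \<bullet> ez - \<sigma> / 2 * (norm ez)\<^sup>2)"
    using fy gz p by (intro mult_left_mono) (auto simp: gap_def)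
  have expand: "pen k * ((l k + (res k - C *v step k)) \<bullet> (B *v ey) + (P k *v dy) \<bullet> ey
      + (l k + res k) \<bullet> (C *v ez) + (Q *v step k) \<bullet> ez - \<sigma> / 2 * (norm ez)\<^sup>2)
    = - ((l k + res k) \<bullet> res k) + (C *v step k) \<bullet> res k
      + pen k * ((C *v step k) \<bullet> (C *v ez) + (Q *v step k) \<bullet> ez)
      + pen k * (ey \<bullet> (P k *v dy)) - pen k * \<sigma> / 2 * (norm ez)\<^sup>2"
    by (simp add: res inner_add_left inner_add_right inner_diff_left inner_commute algebra_simps)
  have quad: "(C *v step k) \<bullet> (C *v ez) + (Q *v step k) \<bullet> ez = pen k * (ez \<bullet> (G *v dz))"
  proof -
    have "ez \<bullet> (transpose C *v (C *v dz)) = (C *v ez) \<bullet> (C *v dz)"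
      by (metis dot_lmul_matrix inner_commute transpose_matrix_vector)
    then show ?thesis
      by (simp add: step matrix_vector_mult_scaleR matrix_vector_mult_add_rdistrib inner_add_right
          inner_commute distrib_left flip: matrix_vector_mul_assoc)
  qed
  have zpart: "pen k * (pen k * (ez \<bullet> (G *v dz)))
      = (pen k)\<^sup>2 / 2 * qform G (zstar - z k) - (pen k)\<^sup>2 / 2 * qform G ez
        - 1 / 2 * (norm (C *v step k))\<^sup>2 - 1 / 2 * qform Q (step k)"
  proof -
    have three: "2 * (ez \<bullet> (G *v dz)) = qform G (zstar - z k) - qform G ez - qform G dz"
      using qform_three_point[of G zstar "z (k + 1)" "z k"] psd_gram_add[OF Q, of C]
      unfolding psd_def defs by blast
    have "(pen k)\<^sup>2 * qform G dz = (norm (C *v step k))\<^sup>2 + qform Q (step k)"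
      by (simp add: step qform_scaleR matrix_vector_mult_scaleR qform_gram_add power_mult_distrib distrib_left)
    moreover have "pen k * (pen k * (ez \<bullet> (G *v dz))) = (pen k)\<^sup>2 / 2 * (2 * (ez \<bullet> (G *v dz)))"
      by (simp add: power2_eq_square)
    ultimately show ?thesis unfolding three right_diff_distrib by linarith
  qed
  have ypart: "pen k * (ey \<bullet> (P k *v dy)) \<le> pen k / 2 * qform (P k) (ystar - y k) - pen k / 2 * qform (P k) ey"
  proof -
    have "2 * (ey \<bullet> (P k *v dy)) \<le> qform (P k) (ystar - y k) - qform (P k) ey"
      using qform_three_point[of "P k" ystar "y (k + 1)" "y k"] P(1)[OF k] psd_qform_nonneg[OF P(1)[OF k], of dy]
      by (simp add: psd_def defs)
    from mult_left_mono[OF this, of "pen k / 2"] show ?thesis using p by (simp add: algebra_simps)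
  qed
  have lpart: "- ((l k + res k) \<bullet> res k)
      = (norm (l k))\<^sup>2 / (2 * \<gamma>) - (norm (l (k + 1)))\<^sup>2 / (2 * \<gamma>) + (\<gamma> / 2 - 1) * (norm (res k))\<^sup>2"
  proof -
    have "(norm (l (k + 1)))\<^sup>2 = (norm (l k))\<^sup>2 + 2 * \<gamma> * (l k \<bullet> res k) + \<gamma>\<^sup>2 * (norm (res k))\<^sup>2"
      using multiplier_update[OF k]
      unfolding power2_norm_eq_inner
      by (simp add: inner_add_left inner_add_right inner_commute power2_eq_square)
    then show ?thesis using \<gamma>(1)
      by (simp add: inner_add_left field_simps power2_eq_square flip: power2_norm_eq_inner)
  qed
  have "potential (k + 1) \<le> (norm (l (k + 1)))\<^sup>2 / (2 * \<gamma>)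
      + ((pen k)\<^sup>2 / 2 * qform G ez + pen k * \<sigma> / 2 * (norm ez)\<^sup>2) + pen k / 2 * qform (P k) ey"
    using penalty_growth[OF k, of ez] proximal_monotone[OF k, of ey]
    by (simp add: potential_def defs)
  then show ?thesis
    using bound ypart unfolding expand quad zpart lpart potential_def[of k] by linarith
qed

text \<open>Monotonicity of the subdifferential of \<open>g\<close> at two consecutive iterates. The multipliers in the two
  subgradients differ by \<open>\<gamma>\<close> times the old residual, of which the old subgradient already contains one
  copy; this leaves the factor \<open>\<gamma> - 1\<close>.\<close>

lemma cross_term:
  assumes k: "1 \<le> k"
  shows "(C *v step (k + 1)) \<bullet> res (k + 1)
    \<le> - ((\<gamma> - 1) * ((C *v step (k + 1)) \<bullet> res k)) - qform Q (step (k + 1)) + step (k + 1) \<bullet> (Q *v step k)"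
proof -
  define dz where "dz = z (k + 2) - z (k + 1)"
  have step: "step (k + 1) = pen (k + 1) *\<^sub>R dz" by (simp add: step_def dz_def)
  have adj: "(transpose C *v u) \<bullet> dz = u \<bullet> (C *v dz)" for u by (simp add: dot_lmul_matrix)
  have "0 \<le> (- (transpose C *v (l (k + 1) + res (k + 1)) + Q *v step (k + 1))
      - - (transpose C *v (l k + res k) + Q *v step k)) \<bullet> dz"
    using subdifferential_monotone[OF g(1) subgradient_z[of "k + 1"] subgradient_z[OF k]]
    by (simp add: dz_def)
  also have "\<dots> = - (res (k + 1) \<bullet> (C *v dz)) - (\<gamma> - 1) * (res k \<bullet> (C *v dz))
      - dz \<bullet> (Q *v step (k + 1)) + dz \<bullet> (Q *v step k)"
    unfolding inner_diff_left inner_minus_left inner_add_left[of "transpose C *v _"] adj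
    by (simp add: multiplier_update[OF k, simplified] inner_add_left inner_commute algebra_simps)
  finally have "0 \<le> pen (k + 1) * (- (res (k + 1) \<bullet> (C *v dz)) - (\<gamma> - 1) * (res k \<bullet> (C *v dz))
      - dz \<bullet> (Q *v step (k + 1)) + dz \<bullet> (Q *v step k))"
    using pen_pos[of "k + 1"] by simp
  also have "\<dots> = - ((C *v step (k + 1)) \<bullet> res (k + 1)) - (\<gamma> - 1) * ((C *v step (k + 1)) \<bullet> res k)
      - step (k + 1) \<bullet> (Q *v step (k + 1)) + step (k + 1) \<bullet> (Q *v step k)"
    unfolding step by (simp add: matrix_vector_mult_scaleR inner_commute algebra_simps)
  finally show ?thesis by (simp add: qform_def)
qed

lemma golden_ratio: "(\<gamma> - 1)\<^sup>2 \<le> 2 - \<gamma>"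
proof -
  have "(2 * \<gamma> - 1)\<^sup>2 \<le> (sqrt 5)\<^sup>2"
    using \<gamma> by (intro power_mono) auto
  then show ?thesis by (simp add: power2_eq_square algebra_simps)
qed

lemma energy_descent:
  assumes k: "1 \<le> k"
  shows "pen (k + 1) * gap (k + 2) \<le> energy k - energy (k + 1)"
proof -
  define w where "w = C *v step (k + 1)"
  \<comment> \<open>Young's inequality in the form that uses up the whole \<open>\<parallel>w\<parallel>\<^sup>2 / 2\<close> left by \<open>gap_descent\<close>.\<close>
  have "0 \<le> (norm (w + (\<gamma> - 1) *\<^sub>R res k))\<^sup>2" by simp
  also have "\<dots> = (norm w)\<^sup>2 + 2 * ((\<gamma> - 1) * (w \<bullet> res k)) + (\<gamma> - 1)\<^sup>2 * (norm (res k))\<^sup>2"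
    unfolding power2_norm_eq_inner
    by (simp add: inner_add_left inner_add_right inner_commute power2_eq_square)
  finally have "- ((\<gamma> - 1) * (w \<bullet> res k)) \<le> 1 / 2 * (norm w)\<^sup>2 + (\<gamma> - 1)\<^sup>2 / 2 * (norm (res k))\<^sup>2"
    by simp
  moreover have "2 * (step (k + 1) \<bullet> (Q *v step k)) \<le> qform Q (step (k + 1)) + qform Q (step k)"
    by (rule qform_young[OF Q])
  moreover have "(\<gamma> / 2 - 1) * (norm (res (k + 1)))\<^sup>2 \<le> - ((\<gamma> - 1)\<^sup>2 / 2) * (norm (res (k + 1)))\<^sup>2"
    using golden_ratio by (intro mult_right_mono) auto
  moreover have "0 \<le> qform Q (step (k + 1))" by (rule psd_qform_nonneg[OF Q])
  ultimately show ?thesis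
    using gap_descent[of "k + 1", OF le_add2] cross_term[OF k]
    unfolding energy_def w_def[symmetric] add.assoc one_add_one by linarith
qed

section \<open>Boundedness and rates\<close>

text \<open>The first iteration has no predecessor to compare with, so its gap enters as a constant.\<close>

lemma gap_sum_le:
  assumes "1 \<le> k"
  shows "(\<Sum>i=1..k. pen i * gap (i + 1)) \<le> pen 1 * gap 2 + energy 1 - energy k"
  using assms
proof (induction k rule: dec_induct)
  case (step k)
  then show ?case using energy_descent[of k] by simp
qed (simp add: numeral_2_eq_2)

text \<open>The solution minimises the Lagrangian with multiplier \<open>\<lambda>\<^sup>*\<close>.\<close>

lemma objective_lower_bound:
  assumes "\<bar>f u\<bar> \<noteq> \<infinity>" "\<bar>g w\<bar> \<noteq> \<infinity>"
  shows "- (lstar \<bullet> (B *v u + C *v w - b)) \<le> real_of_ereal (f u) + real_of_ereal (g w)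
     - (real_of_ereal (f ystar) + real_of_ereal (g zstar))"
proof -
  have "(transpose B *v lstar) \<bullet> (u - ystar) = lstar \<bullet> (B *v (u - ystar))"
    "(transpose C *v lstar) \<bullet> (w - zstar) = lstar \<bullet> (C *v (w - zstar))"
    by (simp_all add: dot_lmul_matrix)
  then show ?thesis
    using subdifferential_real[OF f(1) kkt_dual(1) assms(1)] subdifferential_real[OF g(1) kkt_dual(2) assms(2)]
    by (simp add: matrix_vector_mult_diff_distrib inner_add_right inner_diff_right kkt_primal[symmetric])
qed

lemma res_sum:
  assumes "1 \<le> k"
  shows "\<gamma> *\<^sub>R (\<Sum>i=1..k. res i) = l (k + 1) - l 1"
  using assms
proof (induction k rule: dec_induct)
  case base
  then show ?case using multiplier_update[of 1] by (simp add: numeral_2_eq_2)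
next
  case (step k)
  then show ?case using multiplier_update[of "k + 1"] by (simp add: scaleR_add_right)
qed

lemma energy_ge:
  assumes "1 \<le> k"
  shows "(norm (l (k + 1)))\<^sup>2 / (2 * \<gamma>) \<le> energy k"
proof -
  have "0 \<le> qform G w" "0 \<le> qform Q w" for w
    using psd_qform_nonneg[OF psd_gram_add[OF Q]] psd_qform_nonneg[OF Q] .
  moreover have "0 \<le> qform (P (k + 1)) w" for w using psd_qform_nonneg[OF P(1)[OF le_add2]] .
  moreover have "0 < pen (k + 1)" by (simp add: pen_pos)
  ultimately show ?thesis by (simp add: energy_def potential_def)
qed

text \<open>The energy dominates \<open>\<parallel>\<lambda>\<^sup>k\<^sup>+\<^sup>1\<parallel>\<^sup>2 / (2 \<gamma>)\<close>, while the summed gaps can fall at most linearly in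
  \<open>\<lambda>\<^sup>k\<^sup>+\<^sup>1\<close>, by the Lagrangian bound and the telescoped residuals. Completing the square confines
  \<open>\<lambda>\<^sup>k\<^sup>+\<^sup>1\<close> to a ball around \<open>\<lambda>\<^sup>*\<close>.\<close>

lemma multipliers_bounded: "\<exists>M. \<forall>k\<ge>1. norm (l (k + 1)) \<le> M"
proof -
  define K where "K = pen 1 * gap 2 + energy 1"
  define R where "R = 2 * \<gamma> * K - 2 * (lstar \<bullet> l 1) + (norm lstar)\<^sup>2"
  have "norm (l (k + 1)) \<le> norm lstar + sqrt R" if k: "1 \<le> k" for k
  proof -
    have "- (lstar \<bullet> (\<Sum>i=1..k. res i)) = (\<Sum>i=1..k. pen i * - (lstar \<bullet> (B *v y (i + 1) + C *v z (i + 1) - b)))"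
      by (simp add: inner_sum_right res_def sum_negf)
    also have "\<dots> \<le> (\<Sum>i=1..k. pen i * gap (i + 1))"
    proof (intro sum_mono mult_left_mono)
      fix i assume "i \<in> {1..k}"
      then have i: "1 \<le> i" by simp
      show "- (lstar \<bullet> (B *v y (i + 1) + C *v z (i + 1) - b)) \<le> gap (i + 1)"
        unfolding gap_def by (rule objective_lower_bound[OF iterate_finite[OF i]])
      show "0 \<le> pen i" using pen_pos[OF i] by simp
    qed
    also have "\<dots> \<le> K - (norm (l (k + 1)))\<^sup>2 / (2 * \<gamma>)"
      using gap_sum_le[OF k] energy_ge[OF k] by (simp add: K_def)
    finally have "- (lstar \<bullet> (\<Sum>i=1..k. res i)) \<le> K - (norm (l (k + 1)))\<^sup>2 / (2 * \<gamma>)" .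
    from mult_left_mono[OF this, of "2 * \<gamma>"]
    have "- 2 * (lstar \<bullet> (\<gamma> *\<^sub>R (\<Sum>i=1..k. res i))) \<le> 2 * \<gamma> * K - (norm (l (k + 1)))\<^sup>2"
      using \<gamma>(1) by (simp add: right_diff_distrib)
    then have "(norm (l (k + 1) - lstar))\<^sup>2 \<le> R"
      unfolding res_sum[OF k]
      by (simp add: R_def power2_norm_eq_inner inner_diff_left inner_diff_right inner_commute)
    then have "norm (l (k + 1) - lstar) \<le> sqrt R" by (rule real_le_rsqrt)
    then show ?thesis using norm_triangle_sub[of "l (k + 1)" lstar] by linarith
  qed
  then show ?thesis by blast
qed

lemma weight_ge: "\<beta> * real k \<le> weight pen k"
  using sum_mono[of "{1..k}" "\<lambda>_. \<beta>" pen] pen_ge by (simp add: weight_def mult.commute)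

lemma ergodic_bounds:
  "\<exists>K>0. \<forall>k\<ge>1.
     \<bar>\<bar>objective f g (ergodic_avg pen (\<lambda>k. (y k, z k)) k) - objective f g (ystar, zstar)\<bar>\<bar>
       \<le> ereal (K / weight pen k) \<and>
     norm (constr_map B C (ergodic_avg pen (\<lambda>k. (y k, z k)) k) - b) \<le> K / weight pen k"
proof -
  obtain M where M: "\<And>k. 1 \<le> k \<Longrightarrow> norm (l (k + 1)) \<le> M"
    using multipliers_bounded by blast
  define D where "D = (M + norm (l 1)) / \<gamma>"
  \<comment> \<open>\<open>D\<close> serves for feasibility, \<open>norm lstar * D\<close> for the lower and the last summand for the
    upper bound of the objective error; the 1 makes \<open>K\<close> positive.\<close>
  define K where "K = 1 + D + norm lstar * D + \<bar>pen 1 * gap 2 + energy 1\<bar>"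
  have "0 \<le> M" using M[of 1] norm_ge_zero order_trans by blast
  then have D0: "0 \<le> D" using \<gamma>(1) by (simp add: D_def)
  then have LD: "0 \<le> norm lstar * D" by simp
  have K0: "0 < K" "D \<le> K" using D0 LD unfolding K_def by linarith+
  have "\<bar>\<bar>objective f g (ergodic_avg pen (\<lambda>k. (y k, z k)) k) - objective f g (ystar, zstar)\<bar>\<bar>
        \<le> ereal (K / weight pen k) \<and>
      norm (constr_map B C (ergodic_avg pen (\<lambda>k. (y k, z k)) k) - b) \<le> K / weight pen k"
    if k: "1 \<le> k" for k
  proof -
    define W where "W = weight pen k"
    have W: "0 < W" unfolding W_def
      using weight_ge[of k] params(2) k by (meson less_le_trans mult_pos_pos of_nat_0_less_iff zero_less_one)
    define yv zv where "yv = (\<Sum>i=1..k. (pen i / W) *\<^sub>R y (i + 1))" and "zv = (\<Sum>i=1..k. (pen i / W) *\<^sub>R z (i + 1))"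
    have avg: "ergodic_avg pen (\<lambda>k. (y k, z k)) k = (yv, zv)"
      by (rule prod_eqI) (simp_all add: ergodic_avg_def yv_def zv_def W_def fst_sum snd_sum
          scaleR_sum_right)
    have wsum: "(\<Sum>i=1..k. pen i / W) = 1"
      using W by (simp add: W_def weight_def flip: sum_divide_distrib)
    have resid: "B *v yv + C *v zv - b = (1 / (\<gamma> * W)) *\<^sub>R (l (k + 1) - l 1)"
    proof -
      have "B *v yv + C *v zv - b = B *v yv + C *v zv - (\<Sum>i=1..k. pen i / W) *\<^sub>R b"
        by (simp only: wsum scaleR_one)
      also have "\<dots> = (\<Sum>i=1..k. (1 / W) *\<^sub>R res i)"
        unfolding yv_def zv_def
        by (simp add: linear_sum[OF matrix_vector_mul_linear] matrix_vector_mult_scaleR res_def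
            scaleR_sum_left scaleR_diff_right scaleR_add_right sum.distrib sum_subtractf)
      also have "\<dots> = (1 / (\<gamma> * W)) *\<^sub>R (\<gamma> *\<^sub>R (\<Sum>i=1..k. res i))"
        using \<gamma>(1) by (simp add: scaleR_sum_right)
      finally show ?thesis unfolding res_sum[OF k] .
    qed
    have "norm (l (k + 1) - l 1) \<le> M + norm (l 1)"
      using norm_triangle_ineq4[of "l (k + 1)" "l 1"] M[OF k] by linarith
    then have feas: "norm (B *v yv + C *v zv - b) \<le> D / W"
      unfolding resid D_def using W \<gamma>(1) by (simp add: divide_simps)
    have w0: "0 \<le> pen i / W" if "i \<in> {1..k}" for i using that W pen_pos[of i] by simp
    have ne: "{1..k} \<noteq> {}" using k by simp
    have fin: "f (y (i + 1)) \<noteq> \<infinity>" "g (z (i + 1)) \<noteq> \<infinity>" if "i \<in> {1..k}" for i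
      using iterate_finite[of i] that by auto
    have fle: "f yv \<le> ereal (\<Sum>i=1..k. pen i / W * real_of_ereal (f (y (i + 1))))"
      unfolding yv_def by (rule ereal_convex_jensen[OF f _ ne]) (use w0 wsum fin in auto)
    have gle: "g zv \<le> ereal (\<Sum>i=1..k. pen i / W * real_of_ereal (g (z (i + 1))))"
      unfolding zv_def by (rule ereal_convex_jensen[OF g _ ne]) (use w0 wsum fin in auto)
    have fv: "\<bar>f yv\<bar> \<noteq> \<infinity>" and gv: "\<bar>g zv\<bar> \<noteq> \<infinity>"
      using fle gle f(1) g(1) by (auto simp: proper_fun_def)
    define \<Delta> where "\<Delta> = real_of_ereal (f yv) + real_of_ereal (g zv)
      - (real_of_ereal (f ystar) + real_of_ereal (g zstar))"
    have obj: "objective f g (yv, zv) - objective f g (ystar, zstar) = ereal \<Delta>"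
      using fv gv solution_finite
      by (cases "f yv"; cases "g zv"; cases "f ystar"; cases "g zstar") (auto simp: objective_def \<Delta>_def)
    have "\<Delta> \<le> (\<Sum>i=1..k. pen i / W * real_of_ereal (f (y (i + 1)))) + (\<Sum>i=1..k. pen i / W * real_of_ereal (g (z (i + 1))))
        - (\<Sum>i=1..k. pen i / W) * (real_of_ereal (f ystar) + real_of_ereal (g zstar))"
      using fle gle fv gv wsum by (cases "f yv"; cases "g zv") (auto simp: \<Delta>_def)
    also have "\<dots> = (\<Sum>i=1..k. pen i * gap (i + 1)) / W"
      unfolding sum_distrib_right sum_divide_distrib sum.distrib[symmetric] sum_subtractf[symmetric]
      by (intro sum.cong refl) (simp add: gap_def algebra_simps add_divide_distrib diff_divide_distrib)
    also have "\<dots> \<le> K / W"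
    proof -
      have "0 \<le> energy k"
        using energy_ge[OF k] \<gamma>(1) by (meson divide_nonneg_pos less_trans mult_pos_pos order_trans zero_le_power2 zero_less_numeral zero_less_one)
      then have "(\<Sum>i=1..k. pen i * gap (i + 1)) \<le> K"
        using gap_sum_le[OF k] D0 LD unfolding K_def by linarith
      then show ?thesis using W by (simp add: divide_right_mono)
    qed
    finally have upper: "\<Delta> \<le> K / W" .
    have "- \<Delta> \<le> lstar \<bullet> (B *v yv + C *v zv - b)"
      using objective_lower_bound[OF fv gv] by (simp add: \<Delta>_def)
    also have "\<dots> \<le> norm lstar * (D / W)"
      using Cauchy_Schwarz_ineq2[of lstar "B *v yv + C *v zv - b"] mult_left_mono[OF feas, of "norm lstar"]
      by simp
    also have "\<dots> \<le> K / W"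
      using W D0 by (simp add: K_def divide_right_mono)
    finally have "\<bar>\<Delta>\<bar> \<le> K / W" using upper by linarith
    moreover have "D / W \<le> K / W" using K0 W by (simp add: divide_right_mono)
    ultimately show ?thesis
      using feas unfolding avg obj by (simp add: constr_map_def W_def)
  qed
  then show ?thesis using K0(1) by blast
qed

lemma ergodic_rate:
  fixes h :: "nat \<Rightarrow> real"
  assumes c: "0 < c" and h: "\<forall>\<^sub>F k in sequentially. 0 < h k \<and> c * h k \<le> weight pen k"
  shows "ereal_bigo (\<lambda>k. \<bar>objective f g (ergodic_avg pen (\<lambda>k. (y k, z k)) k) - objective f g (ystar, zstar)\<bar>)
      (\<lambda>k. 1 / h k)"
    and "(\<lambda>k. norm (constr_map B C (ergodic_avg pen (\<lambda>k. (y k, z k)) k) - b)) \<in> O(\<lambda>k. 1 / h k)"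
proof -
  let ?obj = "\<lambda>k. \<bar>objective f g (ergodic_avg pen (\<lambda>k. (y k, z k)) k) - objective f g (ystar, zstar)\<bar>"
  let ?con = "\<lambda>k. norm (constr_map B C (ergodic_avg pen (\<lambda>k. (y k, z k)) k) - b)"
  obtain K where K: "0 < K" and bounds: "\<And>k. 1 \<le> k \<Longrightarrow>
      \<bar>?obj k\<bar> \<le> ereal (K / weight pen k) \<and> ?con k \<le> K / weight pen k"
    using ergodic_bounds by blast
  have "\<forall>\<^sub>F k in sequentially. \<bar>?obj k\<bar> \<le> ereal (K / c * norm (1 / h k)) \<and> ?con k \<le> K / c * norm (1 / h k)"
    using h eventually_ge_at_top[of "1::nat"]
  proof eventually_elim
    case (elim k)
    then have pos: "0 < c * h k" using c by simp
    then have "K / weight pen k \<le> K / (c * h k)"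
      using elim K by (intro divide_left_mono) (auto intro!: mult_pos_pos)
    also have "\<dots> = K / c * norm (1 / h k)" using elim by simp
    finally have le: "K / weight pen k \<le> K / c * norm (1 / h k)" .
    then have "ereal (K / weight pen k) \<le> ereal (K / c * norm (1 / h k))" by simp
    from order_trans[OF conjunct1[OF bounds[OF elim(2)]] this] order_trans[OF conjunct2[OF bounds[OF elim(2)]] le]
    show ?case by (rule conjI)
  qed
  note ev = this[unfolded eventually_conj_iff]
  have "0 < K / c" using K c by simp
  then show "ereal_bigo ?obj (\<lambda>k. 1 / h k)"
    unfolding ereal_bigo_def using conjunct1[OF ev] by blast
  show "?con \<in> O(\<lambda>k. 1 / h k)"
    by (rule bigoI[of _ "K / c"]) (use conjunct2[OF ev] in simp)
qed

end

theorem corollary3p4: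
  fixes f :: "real^'n1 \<Rightarrow> ereal" and g :: "real^'n2 \<Rightarrow> ereal"
    and B :: "real^'n1^'m" and C :: "real^'n2^'m" and b :: "real^'m"
    and \<sigma> \<gamma> \<epsilon> \<beta> \<tau> :: real
    and Q :: "real^'n2^'n2" and P :: "nat \<Rightarrow> real^'n1^'n1"
    and y :: "nat \<Rightarrow> real^'n1" and z :: "nat \<Rightarrow> real^'n2"
    and l :: "nat \<Rightarrow> real^'m" and pen :: "nat \<Rightarrow> real"
    and ystar :: "real^'n1" and zstar :: "real^'n2" and lstar :: "real^'m"
    and v :: "nat \<Rightarrow> (real^'n1) \<times> (real^'n2)"
  assumes f: "proper_fun f" "lower_semicont f" "ereal_convex f"
    and g: "proper_fun g" "lower_semicont g" "ereal_convex g"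
    and \<sigma>: "\<sigma> \<ge> 0" "convexity_modulus g \<sigma>"
    and \<gamma>: "\<gamma> \<in> {1<..<(1 + sqrt 5) / 2}"
    and params: "\<epsilon> \<in> {0<..<1}" "\<beta> \<in> {0<..<1}" "\<tau> \<in> {0<..<1}"
    and Q: "psd Q"
    and P: "\<And>k. k \<ge> 1 \<Longrightarrow> psd (P k)"
      "\<And>k. k \<ge> 1 \<Longrightarrow> loewner_le (pen (k + 1) *\<^sub>R P (k + 1)) (pen k *\<^sub>R P k)"
    and lmax: "lambda_max (transpose C ** C + Q) > 0"
    and iterates: "iadmm_iterates f g B C b \<sigma> \<gamma> \<epsilon> \<beta> \<tau> Q P y z l pen"
    and kkt: "kkt_solution f g B C b ystar zstar lstar"
    and v: "v = ergodic_avg pen (\<lambda>k. (y k, z k))"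
  shows "ereal_bigo (\<lambda>k. \<bar>objective f g (v k) - objective f g (ystar, zstar)\<bar>) (\<lambda>k. 1 / real k)
    \<and> (\<lambda>k. norm (constr_map B C (v k) - b)) \<in> O(\<lambda>k. 1 / real k)
    \<and> (weight pen \<in> \<Omega>(\<lambda>k. (real k)\<^sup>2) \<longrightarrow>
         ereal_bigo (\<lambda>k. \<bar>objective f g (v k) - objective f g (ystar, zstar)\<bar>) (\<lambda>k. 1 / (real k)\<^sup>2)
       \<and> (\<lambda>k. norm (constr_map B C (v k) - b)) \<in> O(\<lambda>k. 1 / (real k)\<^sup>2))"
proof -
  interpret iadmm_run f g B C b \<sigma> \<gamma> \<epsilon> \<beta> \<tau> Q P y z l pen ystar zstar lstar
    by unfold_locales (use assms in auto)
  have "\<forall>\<^sub>F k in sequentially. 0 < real k \<and> \<beta> * real k \<le> weight pen k"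
    using eventually_gt_at_top[of "0::nat"] by eventually_elim (simp add: weight_ge)
  note linear = ergodic_rate[OF iadmm_run.params(2)[OF iadmm_run_axioms] this]
  have quadratic: "ereal_bigo (\<lambda>k. \<bar>objective f g (v k) - objective f g (ystar, zstar)\<bar>) (\<lambda>k. 1 / (real k)\<^sup>2)
      \<and> (\<lambda>k. norm (constr_map B C (v k) - b)) \<in> O(\<lambda>k. 1 / (real k)\<^sup>2)"
    if \<Omega>: "weight pen \<in> \<Omega>(\<lambda>k. (real k)\<^sup>2)"
  proof -
    obtain c where c: "0 < c" "\<forall>\<^sub>F k in sequentially. c * norm ((real k)\<^sup>2) \<le> norm (weight pen k)"
      using landau_omega.bigE[OF \<Omega>] by blast
    have "\<forall>\<^sub>F k in sequentially. 0 < (real k)\<^sup>2 \<and> c * (real k)\<^sup>2 \<le> weight pen k"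
      using c(2) eventually_gt_at_top[of "0::nat"]
    proof eventually_elim
      case (elim k)
      have "0 \<le> \<beta> * real k" using iadmm_run.params(2)[OF iadmm_run_axioms] by simp
      then have "0 \<le> weight pen k" using weight_ge[of k] by linarith
      then show ?case using elim by simp
    qed
    from ergodic_rate[OF c(1) this] show ?thesis unfolding v by blast
  qed
  show ?thesis using linear quadratic unfolding v by blast
qed

end
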